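(* Consider a finite discounted MDP with $\mathcal S_{\mathrm{sep}}\neq\varnothing$, and fix any $\delta\in(0,\bar\Delta/2)$. For $r>0$ let $$\mathcal T_r:=\{Q\in\mathbb R^n:\operatorname{dist}_\infty(Q,\mathcal X_1)\le r\}.$$ Then $\mathcal T_\delta\subset\mathcal X^*$. Moreover, $$F(\mathcal T_\delta)\subset\mathcal T_{\gamma\delta}\subset\mathcal T_\delta,$$ so $\mathcal T_\delta$ is invariant under the Bellman operator $F$.
   Context: Finite discounted MDP: finite nonempty state set $\mathcal S$ and action set $\mathcal A$, transition probabilities $P(s'|s,a)$, expected one-step rewards $R(s,a)\in\mathbb R$, discount $\gamma\in(0,1)$. Put $n=|\mathcal S||\mathcal A|$ and identify functions $Q:\mathcal S\times\mathcal A\to\mathbb R$ with vectors in $\mathbb R^n$. Bellman operator: $(FQ)(s,a)=R(s,a)+\gamma\sum_{s'}P(s'|s,a)\max_{a'}Q(s',a')$. $Q^*$ is the optimal Q-function, the unique fixed point of $F$; $V^*(s)=\max_aQ^*(s,a)$. $\pi_Q(s)$ is a greedy action of $Q$ at $s$, i.e. the element of $\operatorname{Arg\,max}_aQ(s,a)$ selected by a fixed tie-breaking rule. $\Phi^*(s):=\operatorname{Arg\,max}_{a\in\mathcal A}Q^*(s,a)$ (a set). Practically optimal solution set: $\mathcal X^*:=\{Q\in\mathbb R^n:\pi_Q(s)\in\Phi^*(s)\ \forall s\in\mathcal S\}$. $\mathcal S_{\mathrm{sep}}:=\{s:\Phi^*(s)\ne\mathcal A\}$; for $s\in\mathcal S_{\mathrm{sep}}$,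 $\bar\Delta_s:=V^*(s)-\max_{a\notin\Phi^*(s)}Q^*(s,a)$; $\bar\Delta:=\min_{s\in\mathcal S_{\mathrm{sep}}}\bar\Delta_s>0$. $\mathbf 1\in\mathbb R^n$ is the all-ones vector, $\mathcal X_1:=Q^*+\operatorname{span}(\mathbf 1)$, $\operatorname{dist}_\infty(Q,\mathcal Y)=\inf_{y\in\mathcal Y}\|Q-y\|_\infty$. *)

theory Defs
  imports "HOL-Analysis.Analysis" "HOL-Probability.Probability_Mass_Function"
begin

text \<open>
  A finite discounted MDP is given by a kernel \<open>P\<close>, rewards \<open>R\<close> and a discount factor \<open>\<gamma>\<close>; states
  and actions range over arbitrary finite types, and \<open>pmf (P s a) s'\<close> is the probability
  of moving from \<open>s\<close> to \<open>s'\<close> under \<open>a\<close>.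
  Q-functions are vectors indexed by state-action pairs, so that \<open>infnorm\<close> is the maximum norm
  and \<open>1\<close> is the all-ones vector.
\<close>

type_synonym ('s, 'a) qfun = "real ^ ('s \<times> 'a)"

definition bellman ::
  "('s::finite \<Rightarrow> 'a::finite \<Rightarrow> 's pmf) \<Rightarrow> ('s \<Rightarrow> 'a \<Rightarrow> real) \<Rightarrow> real \<Rightarrow> ('s, 'a) qfun \<Rightarrow> ('s, 'a) qfun"
  where "bellman P R \<gamma> Q =
    vec_lambda (\<lambda>(s, a). R s a + \<gamma> * (\<Sum>s'\<in>UNIV. pmf (P s a) s' * (MAX a'\<in>UNIV. Q $ (s', a'))))"

text \<open>Well defined for \<open>0 < \<gamma> < 1\<close>, see \<open>bellman_ex1_fixed_point\<close> below.\<close>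

definition qstar ::
  "('s::finite \<Rightarrow> 'a::finite \<Rightarrow> 's pmf) \<Rightarrow> ('s \<Rightarrow> 'a \<Rightarrow> real) \<Rightarrow> real \<Rightarrow> ('s, 'a) qfun"
  where "qstar P R \<gamma> = (THE Q. bellman P R \<gamma> Q = Q)"

definition vstar ::
  "('s::finite \<Rightarrow> 'a::finite \<Rightarrow> 's pmf) \<Rightarrow> ('s \<Rightarrow> 'a \<Rightarrow> real) \<Rightarrow> real \<Rightarrow> 's \<Rightarrow> real"
  where "vstar P R \<gamma> s = (MAX a\<in>UNIV. qstar P R \<gamma> $ (s, a))"

definition greedy_actions :: "('s::finite, 'a::finite) qfun \<Rightarrow> 's \<Rightarrow> 'a set"
  where "greedy_actions Q s = {a. is_arg_max (\<lambda>a. Q $ (s, a)) (\<lambda>a. a \<in> UNIV) a}"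

definition optimal_actions ::
  "('s::finite \<Rightarrow> 'a::finite \<Rightarrow> 's pmf) \<Rightarrow> ('s \<Rightarrow> 'a \<Rightarrow> real) \<Rightarrow> real \<Rightarrow> 's \<Rightarrow> 'a set"
  where "optimal_actions P R \<gamma> s = greedy_actions (qstar P R \<gamma>) s"

text \<open>A tie-breaking rule picks an element of every nonempty set of tied actions; it may depend
  on the state.\<close>

definition tie_breaking_rule :: "('s \<Rightarrow> 'a set \<Rightarrow> 'a) \<Rightarrow> bool"
  where "tie_breaking_rule \<tau> \<longleftrightarrow> (\<forall>s B. B \<noteq> {} \<longrightarrow> \<tau> s B \<in> B)"

definition greedy_policy ::
  "('s::finite \<Rightarrow> 'a::finite set \<Rightarrow> 'a) \<Rightarrow> ('s, 'a) qfun \<Rightarrow> 's \<Rightarrow> 'a"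
  where "greedy_policy \<tau> Q s = \<tau> s (greedy_actions Q s)"

definition practically_optimal ::
  "('s::finite \<Rightarrow> 'a::finite set \<Rightarrow> 'a) \<Rightarrow> ('s \<Rightarrow> 'a \<Rightarrow> 's pmf) \<Rightarrow> ('s \<Rightarrow> 'a \<Rightarrow> real) \<Rightarrow> real \<Rightarrow>
    ('s, 'a) qfun set"
  where "practically_optimal \<tau> P R \<gamma> =
    {Q. \<forall>s. greedy_policy \<tau> Q s \<in> optimal_actions P R \<gamma> s}"

definition separated_states ::
  "('s::finite \<Rightarrow> 'a::finite \<Rightarrow> 's pmf) \<Rightarrow> ('s \<Rightarrow> 'a \<Rightarrow> real) \<Rightarrow> real \<Rightarrow> 's set"
  where "separated_states P R \<gamma> = {s. optimal_actions P R \<gamma> s \<noteq> UNIV}"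

definition state_gap ::
  "('s::finite \<Rightarrow> 'a::finite \<Rightarrow> 's pmf) \<Rightarrow> ('s \<Rightarrow> 'a \<Rightarrow> real) \<Rightarrow> real \<Rightarrow> 's \<Rightarrow> real"
  where "state_gap P R \<gamma> s =
    vstar P R \<gamma> s - (MAX a\<in>UNIV - optimal_actions P R \<gamma> s. qstar P R \<gamma> $ (s, a))"

definition action_gap ::
  "('s::finite \<Rightarrow> 'a::finite \<Rightarrow> 's pmf) \<Rightarrow> ('s \<Rightarrow> 'a \<Rightarrow> real) \<Rightarrow> real \<Rightarrow> real"
  where "action_gap P R \<gamma> = (MIN s\<in>separated_states P R \<gamma>. state_gap P R \<gamma> s)"

definition qstar_line ::
  "('s::finite \<Rightarrow> 'a::finite \<Rightarrow> 's pmf) \<Rightarrow> ('s \<Rightarrow> 'a \<Rightarrow> real) \<Rightarrow> real \<Rightarrow> ('s, 'a) qfun set"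
  where "qstar_line P R \<gamma> = (\<lambda>v. qstar P R \<gamma> + v) ` span {1}"

definition infdist_max :: "('s::finite, 'a::finite) qfun \<Rightarrow> ('s, 'a) qfun set \<Rightarrow> real"
  where "infdist_max Q Y = (INF y\<in>Y. infnorm (Q - y))"

definition tube ::
  "('s::finite \<Rightarrow> 'a::finite \<Rightarrow> 's pmf) \<Rightarrow> ('s \<Rightarrow> 'a \<Rightarrow> real) \<Rightarrow> real \<Rightarrow> real \<Rightarrow> ('s, 'a) qfun set"
  where "tube P R \<gamma> r = {Q. infdist_max Q (qstar_line P R \<gamma>) \<le> r}"


lemma abs_nth_le_infnorm: "\<bar>x $ i\<bar> \<le> infnorm (x :: real ^ 'n)"
  using component_le_infnorm_cart by blast

lemma infnorm_le:
  assumes "\<And>i. \<bar>x $ i\<bar> \<le> c" shows "infnorm (x :: real ^ 'n) \<le> c"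
  unfolding infnorm_cart by (rule cSup_least) (use assms in auto)

lemma abs_Max_diff_le:
  fixes f g :: "'a::finite \<Rightarrow> real"
  assumes "\<And>a. \<bar>f a - g a\<bar> \<le> c"
  shows "\<bar>(MAX a\<in>UNIV. f a) - (MAX a\<in>UNIV. g a)\<bar> \<le> c"
proof -
  have "(MAX a\<in>UNIV. f a) \<le> (MAX a\<in>UNIV. g a) + c"
    if le: "\<And>a. f a \<le> g a + c" for f g :: "'a \<Rightarrow> real"
  proof (rule Max.boundedI)
    fix y assume "y \<in> range f"
    then obtain a where y: "y = f a" by auto
    have "g a \<le> (MAX a\<in>UNIV. g a)" by (rule Max_ge) auto
    then show "y \<le> (MAX a\<in>UNIV. g a) + c" using le[of a] y by linarith
  qed auto
  from this[of f g] this[of g f] show ?thesis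
    using assms by (smt (verit, best))
qed

lemma bellman_contraction:
  assumes "0 \<le> \<gamma>"
  shows "infnorm (bellman P R \<gamma> Q - bellman P R \<gamma> Q') \<le> \<gamma> * infnorm (Q - Q')"
proof (rule infnorm_le)
  fix i :: "'a \<times> 'b"
  obtain s a where i: "i = (s, a)" by (cases i)
  define m where "m Q s' = (MAX a'\<in>UNIV. Q $ (s', a'))" for Q :: "('a, 'b) qfun" and s'
  have m: "\<bar>m Q s' - m Q' s'\<bar> \<le> infnorm (Q - Q')" for s'
    unfolding m_def
    by (rule abs_Max_diff_le) (metis abs_nth_le_infnorm vector_minus_component)
  have "\<bar>\<Sum>s'\<in>UNIV. pmf (P s a) s' * (m Q s' - m Q' s')\<bar>
      \<le> (\<Sum>s'\<in>UNIV. pmf (P s a) s' * infnorm (Q - Q'))"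
    by (rule order_trans[OF sum_abs], rule sum_mono)
      (simp add: abs_mult mult_left_mono m)
  also have "\<dots> = infnorm (Q - Q')"
    by (simp add: sum_pmf_eq_1 flip: sum_distrib_right)
  finally have "\<bar>\<Sum>s'\<in>UNIV. pmf (P s a) s' * (m Q s' - m Q' s')\<bar> \<le> infnorm (Q - Q')" .
  moreover have "(bellman P R \<gamma> Q - bellman P R \<gamma> Q') $ i
      = \<gamma> * (\<Sum>s'\<in>UNIV. pmf (P s a) s' * (m Q s' - m Q' s'))"
    by (simp add: bellman_def i m_def right_diff_distrib sum_subtractf)
  ultimately show "\<bar>(bellman P R \<gamma> Q - bellman P R \<gamma> Q') $ i\<bar> \<le> \<gamma> * infnorm (Q - Q')"
    using assms by (simp add: abs_mult mult_left_mono)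
qed

lemma bellman_ex1_fixed_point:
  assumes "0 < \<gamma>" "\<gamma> < 1"
  shows "\<exists>!Q. bellman P R \<gamma> Q = (Q :: ('s::finite, 'a::finite) qfun)"
proof -
  let ?F = "bellman P R \<gamma> :: ('s, 'a) qfun \<Rightarrow> _"
  define C where "C = sqrt (real DIM(('s, 'a) qfun))"
  have C: "C > 0" by (simp add: C_def)
  have pow: "infnorm ((?F ^^ k) Q - (?F ^^ k) Q') \<le> \<gamma> ^ k * infnorm (Q - Q')" for k Q Q'
  proof (induction k)
    case (Suc k)
    have "infnorm ((?F ^^ Suc k) Q - (?F ^^ Suc k) Q')
        \<le> \<gamma> * infnorm ((?F ^^ k) Q - (?F ^^ k) Q')"
      using bellman_contraction[of \<gamma> P R "(?F ^^ k) Q" "(?F ^^ k) Q'"] assms by simp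
    also have "\<dots> \<le> \<gamma> * (\<gamma> ^ k * infnorm (Q - Q'))"
      using Suc assms by (intro mult_left_mono) auto
    finally show ?case by (simp add: mult.assoc)
  qed simp
  obtain k where k: "\<gamma> ^ k < 1 / C"
    using real_arch_pow_inv[of "1 / C" \<gamma>] C assms by auto
  let ?c = "C * \<gamma> ^ k"
  have "dist ((?F ^^ k) Q) ((?F ^^ k) Q') \<le> ?c * dist Q Q'" for Q Q'
  proof -
    have "dist ((?F ^^ k) Q) ((?F ^^ k) Q') \<le> C * infnorm ((?F ^^ k) Q - (?F ^^ k) Q')"
      unfolding C_def dist_norm by (rule norm_le_infnorm)
    also have "\<dots> \<le> C * (\<gamma> ^ k * infnorm (Q - Q'))"
      using pow C by (intro mult_left_mono) auto
    also have "\<dots> \<le> C * (\<gamma> ^ k * norm (Q - Q'))"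
      using C assms by (intro mult_left_mono infnorm_le_norm) auto
    finally show ?thesis by (simp add: dist_norm mult.assoc)
  qed
  then have "\<exists>!Q. (?F ^^ k) Q = Q"
    using banach_fix_type[of ?c "?F ^^ k"] C k assms
    by (auto simp: field_simps)
  then obtain Q where Q: "(?F ^^ k) Q = Q" and uniq: "\<And>Q'. (?F ^^ k) Q' = Q' \<Longrightarrow> Q' = Q"
    by auto
  have "(?F ^^ k) (?F Q) = ?F Q"
    by (metis Q funpow_swap1)
  then have "?F Q = Q" by (rule uniq)
  moreover have "Q' = Q" if "?F Q' = Q'" for Q'
  proof (rule uniq)
    show "(?F ^^ k) Q' = Q'"
      by (induction k) (simp_all add: that)
  qed
  ultimately show ?thesis by blast
qed

end

theory Submission
  imports Defs
begin

text \<open>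
  Since \<open>F (Q + c 1) = F Q + \<gamma> c 1\<close>, the operator maps the line \<open>Q\<^sup>* + span 1\<close> into itself, and being
  a \<open>\<gamma>\<close>-contraction it shrinks the distance to that line by the factor \<open>\<gamma>\<close>. Greedy actions are not
  changed by adding a constant, so a \<open>Q\<close> closer to the line than half the gap cannot rank a
  suboptimal action above an optimal one.
\<close>

lemma bellman_qstar:
  assumes "0 < \<gamma>" "\<gamma> < 1"
  shows "bellman P R \<gamma> (qstar P R \<gamma>) = qstar P R \<gamma>"
  unfolding qstar_def by (rule theI'[OF bellman_ex1_fixed_point[OF assms]])

text \<open>A constant passes through the inner maximum unchanged, and since each
  \<open>P s a\<close> has total mass 1 the expectation preserves it too; only the discount scales
  it.\<close>

lemma bellman_add_const:
  "bellman P R \<gamma> (Q + c *\<^sub>R 1) = bellman P R \<gamma> Q + (\<gamma> * c) *\<^sub>R 1"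
proof -
  have "(MAX a'\<in>UNIV. (Q + c *\<^sub>R 1) $ (s', a')) = (MAX a'\<in>UNIV. Q $ (s', a')) + c" for s'
    using Max_add_commute[of UNIV "\<lambda>a'. Q $ (s', a')" c] by simp
  then show ?thesis
    by (simp add: vec_eq_iff bellman_def algebra_simps sum.distrib sum_pmf_eq_1
        flip: sum_distrib_left)
qed

lemma qstar_line_eq: "qstar_line P R \<gamma> = range (\<lambda>c. qstar P R \<gamma> + c *\<^sub>R 1)"
  by (auto simp: qstar_line_def span_singleton)

lemma infdist_max_le:
  assumes "y \<in> Y" shows "infdist_max Q Y \<le> infnorm (Q - y)"
  unfolding infdist_max_def
  \<comment> \<open>A real infimum bounds its members from below only if the set is bounded below;
    nonnegativity of \<open>infnorm\<close> gives the bound 0.\<close>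
  by (rule cINF_lower[OF _ assms]) (auto intro: bdd_belowI[of _ 0] simp: infnorm_pos_le)

lemma infdist_max_bellman_le:
  assumes "0 < \<gamma>" "\<gamma> < 1"
  shows "infdist_max (bellman P R \<gamma> Q) (qstar_line P R \<gamma>) \<le> \<gamma> * infdist_max Q (qstar_line P R \<gamma>)"
    (is "?d \<le> _")
proof -
  \<comment> \<open>With \<open>\<gamma>\<close> moved to the left, it suffices to show that
    \<open>?d / \<gamma>\<close> is a lower bound of all distances from \<open>Q\<close> to the
    line, so no nearest point is required.\<close>
  have "?d / \<gamma> \<le> infdist_max Q (qstar_line P R \<gamma>)"
    unfolding infdist_max_def[of Q]
  proof (rule cINF_greatest)
    fix y assume "y \<in> qstar_line P R \<gamma>"
    then obtain c where y: "y = qstar P R \<gamma> + c *\<^sub>R 1" by (auto simp: qstar_line_eq)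
    \<comment> \<open>The image of \<open>y\<close> is the point of the line with shift
      \<open>\<gamma> * c\<close>, hence a competitor in the infimum defining
      \<open>?d\<close>.\<close>
    have "bellman P R \<gamma> y \<in> qstar_line P R \<gamma>"
      by (simp add: y bellman_add_const bellman_qstar[OF assms] qstar_line_eq)
    then have "?d \<le> infnorm (bellman P R \<gamma> Q - bellman P R \<gamma> y)"
      by (rule infdist_max_le)
    also have "\<dots> \<le> \<gamma> * infnorm (Q - y)"
      using assms by (intro bellman_contraction) simp
    finally show "?d / \<gamma> \<le> infnorm (Q - y)"
      using assms by (simp add: field_simps)
  qed (simp add: qstar_line_eq)
  then show ?thesis using assms by (simp add: field_simps)
qed

lemma tube_mono: "r \<le> r' \<Longrightarrow> tube P R \<gamma> r \<subseteq> tube P R \<gamma> r'"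
  by (auto simp: tube_def)

lemma bellman_image_tube_subset:
  assumes "0 < \<gamma>" "\<gamma> < 1"
  shows "bellman P R \<gamma> ` tube P R \<gamma> r \<subseteq> tube P R \<gamma> (\<gamma> * r)"
proof (rule image_subsetI)
  fix Q assume "Q \<in> tube P R \<gamma> r"
  then have "\<gamma> * infdist_max Q (qstar_line P R \<gamma>) \<le> \<gamma> * r"
    using assms by (simp add: tube_def)
  then show "bellman P R \<gamma> Q \<in> tube P R \<gamma> (\<gamma> * r)"
    using infdist_max_bellman_le[OF assms, of P R Q] by (simp add: tube_def)
qed

text \<open>The slack \<open>r < r'\<close> replaces attainment of the infimum: some point of the
  line lies at distance below \<open>r'\<close>, and its shift serves all state-action pairs at
  once.\<close>

lemma tube_obtain_shift:
  assumes "Q \<in> tube P R \<gamma> r" "r < r'"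
  obtains c where "\<And>s a. \<bar>Q $ (s, a) - (qstar P R \<gamma> $ (s, a) + c)\<bar> < r'"
proof -
  have "infdist_max Q (qstar_line P R \<gamma>) < r'"
    using assms by (simp add: tube_def)
  moreover have "bdd_below ((\<lambda>y. infnorm (Q - y)) ` qstar_line P R \<gamma>)"
    by (auto intro: bdd_belowI[of _ 0] simp: infnorm_pos_le)
  moreover have "qstar_line P R \<gamma> \<noteq> {}"
    by (simp add: qstar_line_eq)
  ultimately obtain y where "y \<in> qstar_line P R \<gamma>" and y: "infnorm (Q - y) < r'"
    unfolding infdist_max_def by (auto simp: cINF_less_iff)
  then obtain c where c: "y = qstar P R \<gamma> + c *\<^sub>R 1" by (auto simp: qstar_line_eq)
  have "\<bar>Q $ (s, a) - (qstar P R \<gamma> $ (s, a) + c)\<bar> < r'" for s a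
    using abs_nth_le_infnorm[of "Q - y" "(s, a)"] y by (simp add: c)
  then show ?thesis by (rule that)
qed

lemma mem_greedy_actions_iff: "a \<in> greedy_actions Q s \<longleftrightarrow> (\<forall>b. Q $ (s, b) \<le> Q $ (s, a))"
  by (auto simp: greedy_actions_def is_arg_max_linorder)

text \<open>A tie-breaking rule is constrained only on nonempty sets, so this is what makes
  \<open>greedy_policy\<close> actually greedy.\<close>

lemma greedy_actions_nonempty: "greedy_actions Q s \<noteq> {}"
proof -
  have "(MAX a\<in>UNIV. Q $ (s, a)) \<in> range (\<lambda>a. Q $ (s, a))"
    by (rule Max_in) auto
  then obtain a where "(MAX a\<in>UNIV. Q $ (s, a)) = Q $ (s, a)" by (rule rangeE)
  moreover have "Q $ (s, b) \<le> (MAX a\<in>UNIV. Q $ (s, a))" for b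
    by (rule Max_ge) auto
  ultimately have "a \<in> greedy_actions Q s"
    by (simp add: mem_greedy_actions_iff)
  then show ?thesis by blast
qed

lemma action_gap_le:
  assumes "a \<notin> optimal_actions P R \<gamma> s"
  shows "action_gap P R \<gamma> \<le> vstar P R \<gamma> s - qstar P R \<gamma> $ (s, a)"
proof -
  have "s \<in> separated_states P R \<gamma>"
    using assms by (auto simp: separated_states_def)
  then have "action_gap P R \<gamma> \<le> state_gap P R \<gamma> s"
    unfolding action_gap_def by (intro Min_le) auto
  moreover have "qstar P R \<gamma> $ (s, a)
      \<le> (MAX a\<in>UNIV - optimal_actions P R \<gamma> s. qstar P R \<gamma> $ (s, a))"
    using assms by (intro Max_ge) auto
  ultimately show ?thesis by (simp add: state_gap_def)
qed

lemma tube_subset_practically_optimal: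
  fixes P :: "'s::finite \<Rightarrow> 'a::finite \<Rightarrow> 's pmf"
  assumes \<tau>: "tie_breaking_rule \<tau>" and r: "r < action_gap P R \<gamma> / 2"
  shows "tube P R \<gamma> r \<subseteq> practically_optimal \<tau> P R \<gamma>"
proof
  fix Q assume "Q \<in> tube P R \<gamma> r"
  then obtain c where c: "\<And>s a. \<bar>Q $ (s, a) - (qstar P R \<gamma> $ (s, a) + c)\<bar> < action_gap P R \<gamma> / 2"
    using tube_obtain_shift[OF _ r] by blast
  \<comment> \<open>All greedy actions of \<open>Q\<close> are shown optimal, which covers whichever
    one \<open>\<tau>\<close> selects.\<close>
  have "a \<in> optimal_actions P R \<gamma> s" if a: "a \<in> greedy_actions Q s" for s a
  proof (rule ccontr)
    assume "a \<notin> optimal_actions P R \<gamma> s"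
    then have gap: "action_gap P R \<gamma> \<le> vstar P R \<gamma> s - qstar P R \<gamma> $ (s, a)"
      by (rule action_gap_le)
    have "vstar P R \<gamma> s \<in> range (\<lambda>b. qstar P R \<gamma> $ (s, b))"
      unfolding vstar_def by (rule Max_in) auto
    then obtain b where "vstar P R \<gamma> s = qstar P R \<gamma> $ (s, b)" by auto
    moreover have "Q $ (s, b) \<le> Q $ (s, a)"
      using a by (simp add: mem_greedy_actions_iff)
    \<comment> \<open>Writing g for the gap and v for \<open>vstar P R \<gamma> s\<close>, the
      bounds give \<open>Q $ (s, a)\<close> < v + c - g/2 < \<open>Q $ (s, b)\<close>, against
      greediness of \<open>a\<close>.\<close>
    ultimately show False
      using gap c[of s a] c[of s b] by linarith
  qed
  moreover have "greedy_policy \<tau> Q s \<in> greedy_actions Q s" for s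
    using \<tau> greedy_actions_nonempty[of Q s] by (simp add: greedy_policy_def tie_breaking_rule_def)
  ultimately show "Q \<in> practically_optimal \<tau> P R \<gamma>"
    by (simp add: practically_optimal_def)
qed

theorem proposition2:
  fixes P :: "'s::finite \<Rightarrow> 'a::finite \<Rightarrow> 's pmf"
    and R :: "'s \<Rightarrow> 'a \<Rightarrow> real"
    and \<gamma> \<delta> :: real
    and \<tau> :: "'s \<Rightarrow> 'a set \<Rightarrow> 'a"
  assumes "0 < \<gamma>" and "\<gamma> < 1"
    and "tie_breaking_rule \<tau>"
    and "separated_states P R \<gamma> \<noteq> {}"
    and "0 < \<delta>" and "\<delta> < action_gap P R \<gamma> / 2"
  shows "tube P R \<gamma> \<delta> \<subseteq> practically_optimal \<tau> P R \<gamma> \<and>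
    bellman P R \<gamma> ` tube P R \<gamma> \<delta> \<subseteq> tube P R \<gamma> (\<gamma> * \<delta>) \<and>
    tube P R \<gamma> (\<gamma> * \<delta>) \<subseteq> tube P R \<gamma> \<delta> \<and>
    bellman P R \<gamma> ` tube P R \<gamma> \<delta> \<subseteq> tube P R \<gamma> \<delta>"
proof -
  have "\<gamma> * \<delta> \<le> \<delta>"
    using assms(1,2,5) by (simp add: mult_left_le_one_le)
  then have "tube P R \<gamma> (\<gamma> * \<delta>) \<subseteq> tube P R \<gamma> \<delta>"
    by (rule tube_mono)
  then show ?thesis
    using tube_subset_practically_optimal[OF assms(3,6)]
      bellman_image_tube_subset[OF assms(1,2), of P R \<delta>] by blast
qed

end
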